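(* Let $B$ be a finite perfect two-sided skew brace. If $Z(B)=0$, then $$B\simeq \operatorname{Triv}(G)\times\operatorname{aTriv}(H)$$ (as skew braces) for some finite perfect groups $G$ and $H$.
   Context: A skew brace is a triple $(B,+,\cdot)$ such that $(B,+)$ and $(B,\cdot)$ are groups (neither assumed abelian) and $a\cdot(b+c)=a\cdot b-a+a\cdot c$ for all $a,b,c\in B$; both groups have the same identity, denoted $0$. It is two-sided if moreover $(a+b)c=ac-c+bc$ for all $a,b,c\in B$. An isomorphism of skew braces is a bijection that is a homomorphism for both operations; the direct product of skew braces has componentwise operations. For $b\in B$ put $\lambda_b(a)=-b+ba$. A subset $I\subseteq B$ is an ideal if $(I,+)\trianglelefteq(B,+)$, $(I,\cdot)\trianglelefteq(B,\cdot)$ and $\lambda_b(I)\subseteq I$ for all $b\in B$. The center $Z(B)$ is the set of $z\in B$ that are central in both $(B,+)$ and $(B,\cdot)$ and satisfy $\lambda_z=\operatorname{id}_B$. The commutator ideal $[B,B]^B$ is the ideal of $B$ generated by the additive commutators, the multiplicative commutators and the elements $ab-(a+b)$, $a,b\in B$. The skew brace $B$ is perfect if $B=[B,B]^B$. A group is perfect if it equals its derived subgroup (the trivial group is perfect). For a group $(G,\cdot)$, $\operatorname{Triv}(G)=(G,\cdot,\cdot)$ is the skew brace in which both operations equal the group operation, and $\operatorname{aTriv}(G)=(G,\cdot^{\operatorname{op}},\cdot)$ is the skew brace whose additive operation is the opposite operation $a\cdot^{\operatorname{op}}b=b\cdot a$ and whose multiplicative operation is $\cdot$. *)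

theory Defs
  imports "HOL-Algebra.Algebra"
begin

text \<open>
  A skew brace is carried by the record type \<open>'a ring\<close>: \<open>\<oplus>\<close>, \<open>\<zero>\<close> form the additive group
  \<open>add_monoid B\<close> and \<open>\<otimes>\<close>, \<open>\<one>\<close> the multiplicative group \<open>B\<close>. Neither group is assumed abelian;
  \<open>x \<ominus> y\<close> is \<open>x \<oplus> (\<ominus> y)\<close>, in this order. The identity \<open>\<zero> = \<one>\<close> is a consequence of the axioms.
\<close>

locale skew_brace =
  fixes B (structure)
  assumes add_group: "group (add_monoid B)"
    and mult_group: "group B"
    and skew_distrib_left: "\<lbrakk> a \<in> carrier B; b \<in> carrier B; c \<in> carrier B \<rbrakk> \<Longrightarrow>
      a \<otimes> (b \<oplus> c) = a \<otimes> b \<ominus> a \<oplus> a \<otimes> c"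

locale two_sided_skew_brace = skew_brace +
  assumes skew_distrib_right: "\<lbrakk> a \<in> carrier B; b \<in> carrier B; c \<in> carrier B \<rbrakk> \<Longrightarrow>
      (a \<oplus> b) \<otimes> c = a \<otimes> c \<ominus> c \<oplus> b \<otimes> c"

definition skew_brace_iso ::
    "('a, 'm) ring_scheme \<Rightarrow> ('b, 'n) ring_scheme \<Rightarrow> bool"  (infixr "\<simeq>\<^sub>s\<^sub>b" 60)
  where "A \<simeq>\<^sub>s\<^sub>b B \<longleftrightarrow> (\<exists>f. bij_betw f (carrier A) (carrier B) \<and>
           f \<in> hom (add_monoid A) (add_monoid B) \<and> f \<in> hom A B)"

definition skew_lambda :: "('a, 'm) ring_scheme \<Rightarrow> 'a \<Rightarrow> 'a \<Rightarrow> 'a"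
  where "skew_lambda B b a = \<ominus>\<^bsub>B\<^esub> b \<oplus>\<^bsub>B\<^esub> b \<otimes>\<^bsub>B\<^esub> a"

definition skew_ideal :: "'a set \<Rightarrow> ('a, 'm) ring_scheme \<Rightarrow> bool"
  where "skew_ideal I B \<longleftrightarrow> I \<lhd> add_monoid B \<and> I \<lhd> B \<and>
           (\<forall>b \<in> carrier B. skew_lambda B b ` I \<subseteq> I)"

definition gen_skew_ideal :: "('a, 'm) ring_scheme \<Rightarrow> 'a set \<Rightarrow> 'a set"
  where "gen_skew_ideal B S = \<Inter> {I. skew_ideal I B \<and> S \<subseteq> I}"

definition skew_center :: "('a, 'm) ring_scheme \<Rightarrow> 'a set"
  where "skew_center B = {z \<in> carrier B. \<forall>a \<in> carrier B.
           z \<oplus>\<^bsub>B\<^esub> a = a \<oplus>\<^bsub>B\<^esub> z \<and> z \<otimes>\<^bsub>B\<^esub> a = a \<otimes>\<^bsub>B\<^esub> z \<and> skew_lambda B z a = a}"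

definition commutator_ideal :: "('a, 'm) ring_scheme \<Rightarrow> 'a set"
  where "commutator_ideal B = gen_skew_ideal B
           (derived_set (add_monoid B) (carrier B) \<union> derived_set B (carrier B) \<union>
            {a \<otimes>\<^bsub>B\<^esub> b \<ominus>\<^bsub>B\<^esub> (a \<oplus>\<^bsub>B\<^esub> b) | a b. a \<in> carrier B \<and> b \<in> carrier B})"

definition perfect_skew_brace :: "('a, 'm) ring_scheme \<Rightarrow> bool"
  where "perfect_skew_brace B \<longleftrightarrow> carrier B = commutator_ideal B"

definition perfect_group :: "('a, 'm) monoid_scheme \<Rightarrow> bool"
  where "perfect_group G \<longleftrightarrow> carrier G = derived G (carrier G)"

definition Triv :: "('a, 'm) monoid_scheme \<Rightarrow> 'a ring"
  where "Triv G = \<lparr> carrier = carrier G, monoid.mult = monoid.mult G, one = one G,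
           ring.zero = one G, ring.add = monoid.mult G \<rparr>"

definition aTriv :: "('a, 'm) monoid_scheme \<Rightarrow> 'a ring"
  where "aTriv G = \<lparr> carrier = carrier G, monoid.mult = monoid.mult G, one = one G,
           ring.zero = one G, ring.add = (\<lambda>a b. b \<otimes>\<^bsub>G\<^esub> a) \<rparr>"

end

theory Submission
  imports Defs
begin

text \<open>
  Let \<open>S\<close> and \<open>T\<close> be the additive subgroups generated by the elements \<open>-a + ab - b\<close> and
  \<open>-b + ab - a\<close>. They are normal, and expanding \<open>(a + b)(c + d)\<close> in both orders shows that they
  centralise each other. Modulo \<open>S + T\<close> both operations agree and commute, so \<open>S + T = B\<close> by
  perfectness, and \<open>S \<inter> T\<close> lies in the additive center. On the additive center \<open>B\<close> acts by
  \<open>x \<mapsto> -b + bx - x\<close> and by \<open>x \<mapsto> xb - b - x\<close>. Both actions are additive in \<open>b\<close>, no \<open>b\<close> fixes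
  a nonzero element, and a descent on the size of the orbits shows that they vanish.
  Hence the additive center
  is contained in \<open>Z(B) = 0\<close>, so \<open>S \<inter> T = 0\<close>. It follows that \<open>ab = b + a\<close> on \<open>S\<close>, \<open>ab = a + b\<close> on
  \<open>T\<close>, and \<open>B\<close> is the direct product of \<open>T\<close> and \<open>S\<close>.
\<close>

section \<open>Identities in skew braces and the left action \<open>skew_lambda\<close>\<close>

sublocale skew_brace \<subseteq> mult: group B
  by (rule mult_group)

text \<open>The rewrites bring every group fact about \<open>add_monoid B\<close> into ring
  syntax.\<close>

sublocale skew_brace \<subseteq> add: group "add_monoid B"
  rewrites "carrier (add_monoid B) = carrier B"
    and "monoid.mult (add_monoid B) = ring.add B"
    and "one (add_monoid B) = ring.zero B"
    and "m_inv (add_monoid B) = a_inv B"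
  by (rule add_group) (auto simp: a_inv_def)

context skew_brace
begin

lemma add_inv_cancel [simp]:
  assumes "x \<in> carrier B" "y \<in> carrier B"
  shows "\<ominus> x \<oplus> (x \<oplus> y) = y" "x \<oplus> (\<ominus> x \<oplus> y) = y"
  using assms by (simp_all flip: add.m_assoc)

text \<open>Normal form of additive words: differences unfolded, sums nested to the right, negation
  pushed to the letters. With \<open>add_inv_cancel\<close>, simp then settles identities by
  cancellation once distributivity has been applied.\<close>

lemmas word_simps = a_minus_def add.m_assoc add.inv_mult_group

text \<open>Skew distributivity at a = 1, b = c = 0 reads 0 = 0 - 1 + 0.\<close>

lemma zero_eq_one: "\<zero> = \<one>"
proof -
  have "\<one> \<otimes> (\<zero> \<oplus> \<zero>) = \<one> \<otimes> \<zero> \<ominus> \<one> \<oplus> \<one> \<otimes> \<zero>"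
    by (rule skew_distrib_left) auto
  then show ?thesis
    by (metis add.inv_one add.l_one a_minus_def add.inv_closed add.one_closed mult.l_one mult.one_closed add.r_one add.inv_inv)
qed

lemma mult_zero [simp]: "x \<in> carrier B \<Longrightarrow> x \<otimes> \<zero> = x" "x \<in> carrier B \<Longrightarrow> \<zero> \<otimes> x = x"
  by (simp_all add: zero_eq_one)

text \<open>Solve a = a(b + (-b)) = ab - a + a(-b) for the last summand.\<close>

lemma mult_minus:
  assumes "a \<in> carrier B" "b \<in> carrier B"
  shows "a \<otimes> (\<ominus> b) = a \<ominus> a \<otimes> b \<oplus> a"
proof -
  have "a \<ominus> a \<otimes> b \<oplus> a \<otimes> (b \<oplus> \<ominus> b) = a \<otimes> (\<ominus> b)"
    using assms by (subst skew_distrib_left) (simp_all add: word_simps)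
  then show ?thesis
    using assms by simp
qed

lemma lambda_closed [simp]:
  "b \<in> carrier B \<Longrightarrow> x \<in> carrier B \<Longrightarrow> skew_lambda B b x \<in> carrier B"
  by (simp add: skew_lambda_def)

lemma lambda_add:
  assumes "b \<in> carrier B" "x \<in> carrier B" "y \<in> carrier B"
  shows "skew_lambda B b (x \<oplus> y) = skew_lambda B b x \<oplus> skew_lambda B b y"
  using assms by (simp add: skew_lambda_def skew_distrib_left word_simps)

text \<open>Together with \<open>lambda_add\<close> and \<open>lambda_one\<close>, this makes
  \<open>skew_lambda\<close> an action of the multiplicative group by automorphisms of the additive
  group.\<close>

lemma lambda_mult:
  assumes "a \<in> carrier B" "b \<in> carrier B" "x \<in> carrier B"
  shows "skew_lambda B (a \<otimes> b) x = skew_lambda B a (skew_lambda B b x)"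
  using assms
  by (simp add: skew_lambda_def skew_distrib_left mult_minus word_simps mult.m_assoc)

lemma lambda_one [simp]: "x \<in> carrier B \<Longrightarrow> skew_lambda B \<one> x = x"
  by (simp add: skew_lambda_def flip: zero_eq_one)

lemma lambda_zero [simp]: "b \<in> carrier B \<Longrightarrow> skew_lambda B b \<zero> = \<zero>"
  by (simp add: skew_lambda_def)

lemma lambda_minus:
  assumes "b \<in> carrier B" "x \<in> carrier B"
  shows "skew_lambda B b (\<ominus> x) = \<ominus> skew_lambda B b x"
  using assms by (simp add: skew_lambda_def mult_minus word_simps)

section \<open>Perfectness and homomorphisms to abelian groups\<close>

text \<open>The kernel is the same set for both operations, hence an ideal. It contains the three
  kinds of generators, the target being abelian, so it is all of B. Perfectness of B enters the
  whole proof through this lemma.\<close>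

lemma perfect_hom_trivial:
  fixes Q :: "('c, 'd) monoid_scheme" (structure)
  assumes perf: "perfect_skew_brace B" and Q: "comm_group Q"
    and hm: "p \<in> hom B Q" and ha: "p \<in> hom (add_monoid B) Q"
    and b: "b \<in> carrier B"
  shows "p b = \<one>\<^bsub>Q\<^esub>"
proof -
  interpret Q: comm_group Q by (rule Q)
  interpret M: group_hom B Q p
    using hm by unfold_locales
  interpret A: group_hom "add_monoid B" Q p
    using ha by unfold_locales
  have p_add: "p (x \<oplus>\<^bsub>B\<^esub> y) = p x \<otimes>\<^bsub>Q\<^esub> p y" if "x \<in> carrier B" "y \<in> carrier B" for x y
    using A.hom_mult that by simp
  have p_minus: "p (\<ominus>\<^bsub>B\<^esub> x) = inv\<^bsub>Q\<^esub> p x" if "x \<in> carrier B" for x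
    using A.hom_inv that by (simp add: a_inv_def)
  define I where "I = {x \<in> carrier B. p x = \<one>\<^bsub>Q\<^esub>}"
  have "I \<lhd> B" "I \<lhd> add_monoid B"
    using M.normal_kernel A.normal_kernel by (simp_all add: kernel_def I_def)
  moreover have "skew_lambda B c ` I \<subseteq> I" if "c \<in> carrier B" for c
    using that by (auto simp: I_def skew_lambda_def p_add p_minus)
  ultimately have ideal: "skew_ideal I B"
    by (simp add: skew_ideal_def)
  have cancel: "x \<otimes>\<^bsub>Q\<^esub> y \<otimes>\<^bsub>Q\<^esub> inv\<^bsub>Q\<^esub> x \<otimes>\<^bsub>Q\<^esub> inv\<^bsub>Q\<^esub> y = \<one>\<^bsub>Q\<^esub>" if "x \<in> carrier Q" "y \<in> carrier Q" for x y
    using that by (metis Q.inv_solve_right' Q.l_one Q.m_comm Q.m_closed Q.one_closed)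
  have "commutator_ideal B \<subseteq> I"
    unfolding commutator_ideal_def gen_skew_ideal_def
  proof (rule Inter_lower, simp only: mem_Collect_eq, intro conjI ideal Un_least subsetI)
    fix x assume "x \<in> derived_set (add_monoid B) (carrier B)"
    then show "x \<in> I"
      by (auto simp: I_def p_add p_minus cancel simp flip: a_inv_def)
  next
    fix x assume "x \<in> derived_set B (carrier B)"
    then show "x \<in> I"
      by (auto simp: I_def cancel)
  next
    fix x assume "x \<in> {a \<otimes>\<^bsub>B\<^esub> b \<ominus>\<^bsub>B\<^esub> (a \<oplus>\<^bsub>B\<^esub> b) | a b. a \<in> carrier B \<and> b \<in> carrier B}"
    then show "x \<in> I"
      by (auto simp: I_def p_add p_minus a_minus_def)
  qed
  with perf b show ?thesis
    by (auto simp: perfect_skew_brace_def I_def)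
qed

text \<open>Modulo the derived subgroup of G both orders of a product agree, so p followed by the
  quotient map respects both operations and is trivial by \<open>perfect_hom_trivial\<close>. The
  disjunction in the hypothesis lets the argument serve \<open>Triv\<close> and \<open>aTriv\<close>
  alike.\<close>

lemma perfect_group_image:
  fixes G :: "('c, 'd) monoid_scheme" (structure)
  assumes perf: "perfect_skew_brace B" and G: "group G"
    and hm: "p \<in> hom B G" and surj: "p ` carrier B = carrier G"
    and p_add: "\<And>a b. a \<in> carrier B \<Longrightarrow> b \<in> carrier B \<Longrightarrow>
      p (a \<oplus>\<^bsub>B\<^esub> b) = p a \<otimes>\<^bsub>G\<^esub> p b \<or> p (a \<oplus>\<^bsub>B\<^esub> b) = p b \<otimes>\<^bsub>G\<^esub> p a"
  shows "perfect_group G"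
proof -
  interpret G: group G by (rule G)
  let ?D = "derived G (carrier G)"
  interpret D: normal ?D G by (rule G.derived_self_is_normal)
  interpret Q: comm_group "G Mod ?D" by (rule G.derived_quot_is_comm_group)
  let ?q = "\<lambda>x. ?D #>\<^bsub>G\<^esub> x"
  have q: "?q \<in> hom G (G Mod ?D)" by (rule D.r_coset_hom_Mod)
  have pc: "p a \<in> carrier G" if "a \<in> carrier B" for a
    using surj that by blast
  have qc: "?q g \<in> carrier (G Mod ?D)" if "g \<in> carrier G" for g
    using q that by (rule hom_in_carrier)
  have 1: "?q \<circ> p \<in> hom B (G Mod ?D)"
    using hm q by (rule hom_compose)
  have 2: "?q \<circ> p \<in> hom (add_monoid B) (G Mod ?D)"
  proof (rule homI)
    fix a b assume "a \<in> carrier (add_monoid B)" "b \<in> carrier (add_monoid B)"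
    then have ab: "a \<in> carrier B" "b \<in> carrier B" by simp_all
    show "(?q \<circ> p) (a \<otimes>\<^bsub>add_monoid B\<^esub> b) = (?q \<circ> p) a \<otimes>\<^bsub>G Mod ?D\<^esub> (?q \<circ> p) b"
    proof -
      have "?q (p a) \<otimes>\<^bsub>G Mod ?D\<^esub> ?q (p b) = ?q (p b) \<otimes>\<^bsub>G Mod ?D\<^esub> ?q (p a)"
        by (intro Q.m_comm qc pc ab)
      then show ?thesis
        using p_add[OF ab] hom_mult[OF q pc[OF ab(1)] pc[OF ab(2)]] hom_mult[OF q pc[OF ab(2)] pc[OF ab(1)]]
        unfolding comp_apply monoid_record_simps by metis
    qed
  next
    fix a assume "a \<in> carrier (add_monoid B)"
    then show "(?q \<circ> p) a \<in> carrier (G Mod ?D)"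
      unfolding comp_apply by (intro qc pc) simp
  qed
  have "g \<in> ?D" if g: "g \<in> carrier G" for g
  proof -
    obtain b where b: "b \<in> carrier B" "g = p b"
      using g surj by blast
    have "(?q \<circ> p) b = \<one>\<^bsub>G Mod ?D\<^esub>"
      by (rule perfect_hom_trivial[OF perf Q.comm_group_axioms 1 2 b(1)])
    then have "?q g = ?D"
      unfolding comp_apply b(2) FactGroup_def by simp
    then show ?thesis
      by (rule G.coset_join1[OF _ g D.subgroup_axioms])
  qed
  then have "carrier G \<subseteq> ?D" by (rule subsetI)
  moreover have "?D \<subseteq> carrier G" by (rule G.derived_in_carrier) simp
  ultimately show ?thesis
    unfolding perfect_group_def by (rule equalityI)
qed

subsection \<open>The additive center\<close>

text \<open>
  Induction on the size of the orbit \<open>{f b x | b}\<close>. The orbit of \<open>y = f b x\<close> is contained in that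
  of \<open>x\<close>; if they are equal, then \<open>y\<close> is fixed by some \<open>c\<close> and so \<open>y = 0\<close>. Otherwise \<open>f c y = 0\<close> for
  all \<open>c\<close> by induction, whence \<open>b \<mapsto> f b x\<close> is a homomorphism from \<open>B\<close> to an abelian group. The
  two forms of \<open>mult\<close> cover left and right actions.
\<close>

lemma perfect_action_trivial:
  assumes perf: "perfect_skew_brace B" and fin: "finite (carrier B)"
    and Z: "subgroup Z (add_monoid B)"
    and comm: "\<And>x y. x \<in> Z \<Longrightarrow> y \<in> Z \<Longrightarrow> x \<oplus> y = y \<oplus> x"
    and closed: "\<And>b x. b \<in> carrier B \<Longrightarrow> x \<in> Z \<Longrightarrow> f b x \<in> Z"
    and zero: "\<And>b. b \<in> carrier B \<Longrightarrow> f b \<zero> = \<zero>"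
    and add: "\<And>a b x. a \<in> carrier B \<Longrightarrow> b \<in> carrier B \<Longrightarrow> x \<in> Z \<Longrightarrow> f (a \<oplus> b) x = f a x \<oplus> f b x"
    and mult: "(\<forall>a\<in>carrier B. \<forall>b\<in>carrier B. \<forall>x\<in>Z. f (a \<otimes> b) x = f a x \<oplus> f b x \<oplus> f a (f b x)) \<or>
      (\<forall>a\<in>carrier B. \<forall>b\<in>carrier B. \<forall>x\<in>Z. f (a \<otimes> b) x = f a x \<oplus> f b x \<oplus> f b (f a x))"
    and no_fix: "\<And>b x. b \<in> carrier B \<Longrightarrow> x \<in> Z \<Longrightarrow> f b x = x \<Longrightarrow> x = \<zero>"
    and "b \<in> carrier B" "x \<in> Z"
  shows "f b x = \<zero>"
proof -
  have Zc: "x \<in> carrier B" if "x \<in> Z" for x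
    using subgroup.mem_carrier[OF Z that] by simp
  have Z0: "\<zero> \<in> Z"
    using subgroup.one_closed[OF Z] by simp
  let ?Z = "add_monoid B\<lparr>carrier := Z\<rparr>"
  have grp: "group ?Z"
    using Z by (rule subgroup.subgroup_is_group) (rule add_group)
  have cg: "comm_group ?Z"
    by (rule group.group_comm_groupI[OF grp]) (simp add: comm)
  define M where "M = {x \<in> Z. \<forall>b \<in> carrier B. f b x = \<zero>}"
  have step: "x \<in> M" if x: "x \<in> Z" and M: "\<And>b. b \<in> carrier B \<Longrightarrow> f b x \<in> M" for x
  proof -
    have "f (a \<otimes> b) x = f a x \<oplus> f b x" if "a \<in> carrier B" "b \<in> carrier B" for a b
      using mult M that x Zc[OF closed] by (auto simp: M_def)
    then have "(\<lambda>b. f b x) \<in> hom B ?Z" "(\<lambda>b. f b x) \<in> hom (add_monoid B) ?Z"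
      using x by (auto simp: hom_def closed add)
    from perfect_hom_trivial[OF perf cg this] show ?thesis
      using x by (simp add: M_def)
  qed
  have f_minus: "f (\<ominus> b) x = \<ominus> f b x" if "b \<in> carrier B" "x \<in> Z" for b x
  proof -
    have c: "f c x \<in> carrier B" if "c \<in> carrier B" for c
      using Zc closed that \<open>x \<in> Z\<close> by blast
    have "f \<zero> x \<oplus> f \<zero> x = f \<zero> x"
      using add[of \<zero> \<zero> x] that by simp
    then have "f \<zero> x = \<zero>"
      using c[of \<zero>] by simp
    then have "f (\<ominus> b) x \<oplus> f b x = \<zero>"
      using add[of "\<ominus> b" b x] that by simp
    then show ?thesis
      using c that by (intro add.inv_equality[symmetric]) auto
  qed
  let ?O = "\<lambda>x. (\<lambda>b. f b x) ` carrier B"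
  have orbit: "?O (f b x) \<subseteq> ?O x" if b: "b \<in> carrier B" and x: "x \<in> Z" for b x
  proof
    fix y assume "y \<in> ?O (f b x)"
    then obtain c where c: "c \<in> carrier B" "y = f c (f b x)" by blast
    note cl = Zc[OF closed[OF b x]] Zc[OF closed[OF c(1) x]] Zc[OF closed[OF c(1) closed[OF b x]]]
    show "y \<in> ?O x"
      using mult
    proof
      assume "\<forall>a\<in>carrier B. \<forall>b\<in>carrier B. \<forall>x\<in>Z. f (a \<otimes> b) x = f a x \<oplus> f b x \<oplus> f a (f b x)"
      \<comment> \<open>By additivity in the first argument, -b - c + cb contributes - f b x - f c x
        + f (cb) x, which leaves exactly the mixed term f c (f b x). In the other case b and c
        change places.\<close>
      then have "f (\<ominus> b \<oplus> (\<ominus> c \<oplus> c \<otimes> b)) x = y"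
        using b c x cl by (simp add: add f_minus word_simps)
      then show ?thesis using b c(1) by (intro image_eqI[where x = "\<ominus> b \<oplus> (\<ominus> c \<oplus> c \<otimes> b)"]) simp_all
    next
      assume "\<forall>a\<in>carrier B. \<forall>b\<in>carrier B. \<forall>x\<in>Z. f (a \<otimes> b) x = f a x \<oplus> f b x \<oplus> f b (f a x)"
      then have "f (\<ominus> c \<oplus> (\<ominus> b \<oplus> b \<otimes> c)) x = y"
        using b c x cl by (simp add: add f_minus word_simps)
      then show ?thesis using b c(1) by (intro image_eqI[where x = "\<ominus> c \<oplus> (\<ominus> b \<oplus> b \<otimes> c)"]) simp_all
    qed
  qed
  have "x \<in> M" if "x \<in> Z" for x
    using that
  proof (induction "card (?O x)" arbitrary: x rule: less_induct)
    case less
    show ?case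
    proof (rule step[OF less.prems])
      fix b assume b: "b \<in> carrier B"
      let ?y = "f b x"
      have y: "?y \<in> Z" by (rule closed[OF b less.prems])
      show "?y \<in> M"
      proof (cases "?O ?y = ?O x")
        case True
        then have "?y \<in> ?O ?y" using b by blast
        then have "?y = \<zero>" using no_fix[OF _ y] by (metis imageE)
        then show ?thesis by (simp add: M_def Z0 zero)
      next
        case False
        then have "card (?O ?y) < card (?O x)"
          using orbit[OF b less.prems] fin by (intro psubset_card_mono) auto
        then show ?thesis using less.hyps y by blast
      qed
    qed
  qed
  then show ?thesis using assms(10,11) by (simp add: M_def)
qed

definition add_center :: "'a set"
  where "add_center = {x \<in> carrier B. \<forall>y \<in> carrier B. x \<oplus> y = y \<oplus> x}"

lemma add_centerI:
  "x \<in> carrier B \<Longrightarrow> (\<And>y. y \<in> carrier B \<Longrightarrow> x \<oplus> y = y \<oplus> x) \<Longrightarrow> x \<in> add_center"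
  by (simp add: add_center_def)

lemma add_center_comm: "x \<in> add_center \<Longrightarrow> y \<in> carrier B \<Longrightarrow> x \<oplus> y = y \<oplus> x"
  by (simp add: add_center_def)

lemma add_center_carrier [simp]: "x \<in> add_center \<Longrightarrow> x \<in> carrier B"
  by (simp add: add_center_def)

lemma add_center_minus [simp]:
  assumes a: "a \<in> add_center"
  shows "\<ominus> a \<in> add_center"
proof -
  have "\<ominus> a \<oplus> y = y \<oplus> \<ominus> a" if y: "y \<in> carrier B" for y
  proof -
    have "\<ominus> a \<oplus> y = \<ominus> a \<oplus> (y \<oplus> a) \<oplus> \<ominus> a"
      using a y by (simp add: add.m_assoc)
    also have "y \<oplus> a = a \<oplus> y"
      using add_center_comm[OF a y] by simp
    also have "\<ominus> a \<oplus> (a \<oplus> y) = y"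
      using a y by simp
    finally show ?thesis .
  qed
  then show ?thesis using a by (intro add_centerI) auto
qed

lemma add_center_add [simp]:
  assumes a: "a \<in> add_center" and b: "b \<in> add_center"
  shows "a \<oplus> b \<in> add_center"
proof -
  have "a \<oplus> b \<oplus> y = y \<oplus> (a \<oplus> b)" if y: "y \<in> carrier B" for y
  proof -
    have "a \<oplus> b \<oplus> y = a \<oplus> (y \<oplus> b)"
      using a b y by (simp add: add.m_assoc add_center_comm[OF b y])
    also have "\<dots> = a \<oplus> y \<oplus> b"
      using a b y by (simp add: add.m_assoc)
    also have "\<dots> = y \<oplus> (a \<oplus> b)"
      using a b y by (simp only: add_center_comm[OF a y] add.m_assoc add_center_carrier)
    finally show ?thesis .
  qed
  then show ?thesis using a b by (intro add_centerI) auto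
qed

lemma add_center_subgroup: "subgroup add_center (add_monoid B)"
proof -
  have "\<zero> \<in> add_center" by (intro add_centerI) auto
  then show ?thesis
    by (intro add.subgroupI) auto
qed

lemma add_center_diff [simp]: "x \<in> add_center \<Longrightarrow> y \<in> add_center \<Longrightarrow> x \<ominus> y \<in> add_center"
  by (simp add: a_minus_def)

text \<open>Every y is some h z, and x commutes with z. Stated for any additive surjection so that
  it covers the left and the right action.\<close>

lemma add_center_endo:
  assumes x: "x \<in> add_center"
    and h: "h ` carrier B = carrier B"
    and add: "\<And>x y. x \<in> carrier B \<Longrightarrow> y \<in> carrier B \<Longrightarrow> h (x \<oplus> y) = h x \<oplus> h y"
  shows "h x \<in> add_center"
proof -
  have "h x \<oplus> y = y \<oplus> h x" if y: "y \<in> carrier B" for y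
  proof -
    obtain z where "z \<in> carrier B" "y = h z" using y h by (metis imageE)
    then show ?thesis
      using x add[of x z] add[of z x] add_center_comm[of x z] by simp
  qed
  moreover have "h x \<in> carrier B" using h x add_center_carrier by blast
  ultimately show ?thesis by (intro add_centerI)
qed

text \<open>This is \<beta>\<alpha> - 1 = (\<beta> - 1) + (\<alpha> - 1) + (\<beta> - 1)(\<alpha> -
  1) evaluated at x, for u = \<alpha> x, v = \<beta> x, w = \<beta>\<alpha> x. It yields the
  hypothesis \<open>mult\<close> of \<open>perfect_action_trivial\<close>.\<close>

lemma add_center_telescope:
  assumes "x \<in> add_center" "u \<in> add_center" "v \<in> add_center" "w \<in> add_center"
  shows "w \<ominus> x = (v \<ominus> x) \<oplus> (u \<ominus> x) \<oplus> ((w \<ominus> v) \<ominus> (u \<ominus> x))"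
proof -
  let ?p = "v \<ominus> x" and ?q = "u \<ominus> x" and ?r = "w \<ominus> v"
  have pqr: "?p \<in> add_center" "?q \<in> add_center" "?r \<in> add_center"
    using assms by simp_all
  have "?p \<oplus> ?q \<oplus> (?r \<ominus> ?q) = ?p \<oplus> ?q \<oplus> (\<ominus> ?q \<oplus> ?r)"
    using pqr by (simp add: a_minus_def[of B ?r ?q] add_center_comm[of ?r])
  also have "\<dots> = ?p \<oplus> ?r"
    using pqr by (simp add: add.m_assoc)
  also have "\<dots> = ?r \<oplus> ?p"
    using pqr by (simp add: add_center_comm)
  also have "\<dots> = w \<ominus> x"
    using assms by (simp add: word_simps)
  finally show ?thesis by simp
qed

lemma lambda_image: "b \<in> carrier B \<Longrightarrow> skew_lambda B b ` carrier B = carrier B"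
proof (intro equalityI subsetI)
  fix y assume b: "b \<in> carrier B" and y: "y \<in> carrier B"
  then have "y = skew_lambda B b (skew_lambda B (inv b) y)"
    by (simp flip: lambda_mult)
  moreover have "skew_lambda B (inv b) y \<in> carrier B"
    using b y by simp
  ultimately show "y \<in> skew_lambda B b ` carrier B"
    by (rule image_eqI)
qed auto

lemma lambda_add_center: "b \<in> carrier B \<Longrightarrow> x \<in> add_center \<Longrightarrow> skew_lambda B b x \<in> add_center"
  using add_center_endo[of x "skew_lambda B b"] by (simp add: lambda_image lambda_add)

end

section \<open>The right action, and triviality of both actions on the additive center\<close>

context two_sided_skew_brace
begin

lemma minus_mult:
  assumes "a \<in> carrier B" "b \<in> carrier B"
  shows "(\<ominus> a) \<otimes> b = b \<ominus> a \<otimes> b \<oplus> b"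
proof -
  have "b \<ominus> a \<otimes> b \<oplus> (a \<oplus> \<ominus> a) \<otimes> b = (\<ominus> a) \<otimes> b"
    using assms by (subst skew_distrib_right) (simp_all add: word_simps)
  then show ?thesis
    using assms by simp
qed

text \<open>The left action of the structure with both operations reversed, which is again a skew
  brace by two-sidedness. Relative to B it is a right action, see \<open>rho_mult\<close>.\<close>

definition skew_rho :: "'a \<Rightarrow> 'a \<Rightarrow> 'a"
  where "skew_rho b x = x \<otimes> b \<ominus> b"

lemma rho_closed [simp]: "b \<in> carrier B \<Longrightarrow> x \<in> carrier B \<Longrightarrow> skew_rho b x \<in> carrier B"
  by (simp add: skew_rho_def a_minus_def)

lemma rho_add:
  assumes "b \<in> carrier B" "x \<in> carrier B" "y \<in> carrier B"
  shows "skew_rho b (x \<oplus> y) = skew_rho b x \<oplus> skew_rho b y"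
  using assms by (simp add: skew_rho_def skew_distrib_right word_simps)

lemma rho_mult:
  assumes "a \<in> carrier B" "b \<in> carrier B" "x \<in> carrier B"
  shows "skew_rho (a \<otimes> b) x = skew_rho b (skew_rho a x)"
  using assms
  by (simp add: skew_rho_def skew_distrib_right minus_mult word_simps mult.m_assoc)

lemma rho_one [simp]: "x \<in> carrier B \<Longrightarrow> skew_rho \<one> x = x"
  by (simp add: skew_rho_def a_minus_def flip: zero_eq_one)

lemma rho_minus:
  assumes "b \<in> carrier B" "x \<in> carrier B"
  shows "skew_rho b (\<ominus> x) = \<ominus> skew_rho b x"
  using assms by (simp add: skew_rho_def minus_mult word_simps)

lemma rho_image: "b \<in> carrier B \<Longrightarrow> skew_rho b ` carrier B = carrier B"
proof (intro equalityI subsetI)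
  fix y assume b: "b \<in> carrier B" and y: "y \<in> carrier B"
  then have "y = skew_rho b (skew_rho (inv b) y)"
    by (simp flip: rho_mult)
  moreover have "skew_rho (inv b) y \<in> carrier B"
    using b y by simp
  ultimately show "y \<in> skew_rho b ` carrier B"
    by (rule image_eqI)
qed auto

lemma rho_add_center: "b \<in> carrier B \<Longrightarrow> x \<in> add_center \<Longrightarrow> skew_rho b x \<in> add_center"
  using add_center_endo[of x "skew_rho b"] by (simp add: rho_image rho_add)

text \<open>This rule and the next two extend the cancellation of \<open>word_simps\<close> across
  central elements; they are stated for right-nested sums to match that normal form.\<close>

lemma add_center_conj [simp]: "x \<in> add_center \<Longrightarrow> y \<in> carrier B \<Longrightarrow> x \<oplus> (y \<oplus> \<ominus> x) = y"
  using add_center_comm[of "\<ominus> x" y, symmetric] by simp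

lemma add_center_conj' [simp]: "x \<in> add_center \<Longrightarrow> y \<in> carrier B \<Longrightarrow> \<ominus> x \<oplus> (y \<oplus> x) = y"
  using add_center_comm[of x y, symmetric] by simp

lemma add_center_conj_by [simp]: "x \<in> add_center \<Longrightarrow> y \<in> carrier B \<Longrightarrow> \<ominus> y \<oplus> (x \<oplus> y) = x"
  using add_center_comm[of x y] by simp

text \<open>\<open>perfect_action_trivial\<close> applies to the difference \<open>?f\<close>.
  Additivity in b rests on right distributivity, which expands (a + b)x; the left action gives the
  first form of \<open>mult\<close>.\<close>

lemma perfect_lambda_add_center:
  assumes perf: "perfect_skew_brace B" and fin: "finite (carrier B)"
    and b: "b \<in> carrier B" and x: "x \<in> add_center"
  shows "skew_lambda B b x = x"
proof -
  let ?f = "\<lambda>b x. skew_lambda B b x \<ominus> x"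
  have "?f b x = \<zero>"
  proof (rule perfect_action_trivial[OF perf fin add_center_subgroup _ _ _ _ _ _ b x])
    fix x y assume "x \<in> add_center" "y \<in> add_center"
    then show "x \<oplus> y = y \<oplus> x" by (simp add: add_center_comm)
  next
    fix b x assume "b \<in> carrier B" "x \<in> add_center"
    then show "?f b x \<in> add_center" by (simp add: lambda_add_center)
  next
    fix b assume "b \<in> carrier B"
    then show "?f b \<zero> = \<zero>" by (simp add: a_minus_def)
  next
    fix a b x assume ab: "a \<in> carrier B" "b \<in> carrier B" and x: "x \<in> add_center"
    have "?f a x \<in> add_center" using ab x by (simp add: lambda_add_center)
    \<comment> \<open>Expanding (a + b)x leaves the contribution of a conjugated by b, which
      centrality undoes.\<close>
    then have "?f a x \<oplus> ?f b x = \<ominus> b \<oplus> (?f a x \<oplus> b) \<oplus> ?f b x"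
      using ab by simp
    also have "\<dots> = ?f (a \<oplus> b) x"
      using ab x by (simp add: skew_lambda_def skew_distrib_right word_simps)
    finally show "?f (a \<oplus> b) x = ?f a x \<oplus> ?f b x" by simp
  next
    have "?f (a \<otimes> b) x = ?f a x \<oplus> ?f b x \<oplus> ?f a (?f b x)"
      if "a \<in> carrier B" "b \<in> carrier B" "x \<in> add_center" for a b x
      using that
        add_center_telescope[of x "skew_lambda B b x" "skew_lambda B a x" "skew_lambda B a (skew_lambda B b x)"]
      by (simp add: lambda_add_center lambda_mult lambda_add lambda_minus a_minus_def)
    then show "(\<forall>a\<in>carrier B. \<forall>b\<in>carrier B. \<forall>x\<in>add_center. ?f (a \<otimes> b) x = ?f a x \<oplus> ?f b x \<oplus> ?f a (?f b x)) \<or>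
      (\<forall>a\<in>carrier B. \<forall>b\<in>carrier B. \<forall>x\<in>add_center. ?f (a \<otimes> b) x = ?f a x \<oplus> ?f b x \<oplus> ?f b (?f a x))"
      by blast
  next
    fix b x assume b: "b \<in> carrier B" and x: "x \<in> add_center" and fx: "?f b x = x"
    have "b \<oplus> ?f b x \<oplus> x = b \<otimes> x"
      using b x by (simp add: skew_lambda_def word_simps)
    then have "b \<otimes> x = b \<oplus> x \<oplus> x"
      by (simp add: fx)
    \<comment> \<open>By \<open>minus_mult\<close> the product is x - (b + x + x) + x, which is -b
      because x is central. Multiplicative cancellation then forces x = 1 = 0.\<close>
    then have "(\<ominus> b) \<otimes> x = \<ominus> b"
      using b x by (simp add: minus_mult word_simps)
    then show "x = \<zero>"
      using b x by (simp add: zero_eq_one)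
  qed
  then show ?thesis
    using b x by (simp add: a_minus_def add.inv_solve_right')
qed

text \<open>The previous argument with sides exchanged: additivity in b now rests on left
  distributivity for x(a + b), and the right action gives the second form of
  \<open>mult\<close>.\<close>

lemma perfect_rho_add_center:
  assumes perf: "perfect_skew_brace B" and fin: "finite (carrier B)"
    and b: "b \<in> carrier B" and x: "x \<in> add_center"
  shows "skew_rho b x = x"
proof -
  let ?f = "\<lambda>b x. skew_rho b x \<ominus> x"
  have "?f b x = \<zero>"
  proof (rule perfect_action_trivial[OF perf fin add_center_subgroup _ _ _ _ _ _ b x])
    fix x y assume "x \<in> add_center" "y \<in> add_center"
    then show "x \<oplus> y = y \<oplus> x" by (simp add: add_center_comm)
  next
    fix b x assume "b \<in> carrier B" "x \<in> add_center"
    then show "?f b x \<in> add_center" by (simp add: rho_add_center)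
  next
    fix b assume "b \<in> carrier B"
    then show "?f b \<zero> = \<zero>" by (simp add: skew_rho_def a_minus_def)
  next
    fix a b x assume ab: "a \<in> carrier B" "b \<in> carrier B" and x: "x \<in> add_center"
    let ?u = "skew_rho a x" and ?v = "skew_rho b x"
    have uv: "?u \<in> add_center" "?v \<in> add_center"
      using ab x by (simp_all add: rho_add_center)
    have "x \<otimes> (a \<oplus> b) = ?u \<oplus> a \<ominus> x \<oplus> (?v \<oplus> b)"
      using ab x by (simp add: skew_distrib_left skew_rho_def word_simps)
    then have "?f (a \<oplus> b) x = ?u \<oplus> (a \<oplus> (\<ominus> x \<oplus> (?v \<oplus> \<ominus> a))) \<ominus> x"
      using ab x uv by (simp add: skew_rho_def word_simps)
    \<comment> \<open>The block -x + \<open>?v\<close> is central, so conjugation by a fixes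
      it.\<close>
    also have "a \<oplus> (\<ominus> x \<oplus> (?v \<oplus> \<ominus> a)) = ?v \<oplus> \<ominus> x"
      using ab x uv add_center_comm[of "\<ominus> x \<oplus> ?v" "\<ominus> a"] add_center_comm[of "?v" "\<ominus> x"]
      by (simp add: add.m_assoc)
    also have "?u \<oplus> (?v \<oplus> \<ominus> x) \<ominus> x = ?f a x \<oplus> ?f b x"
      using ab x uv add_center_comm[of "\<ominus> x" "?v \<oplus> \<ominus> x"]
      by (simp add: word_simps)
    finally show "?f (a \<oplus> b) x = ?f a x \<oplus> ?f b x" .
  next
    have "?f (a \<otimes> b) x = ?f a x \<oplus> ?f b x \<oplus> ?f b (?f a x)"
      if "a \<in> carrier B" "b \<in> carrier B" "x \<in> add_center" for a b x
    proof -
      \<comment> \<open>Since \<open>skew_rho (a \<otimes> b)\<close> applies the action of a first,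
        telescoping puts the term of b in front; this restores the order.\<close>
      have "?f a x \<oplus> ?f b x = ?f b x \<oplus> ?f a x"
        using that by (simp add: add_center_comm rho_add_center)
      then show ?thesis
        using that
          add_center_telescope[of x "skew_rho a x" "skew_rho b x" "skew_rho b (skew_rho a x)"]
        by (simp add: rho_add_center rho_mult rho_add rho_minus a_minus_def)
    qed
    then show "(\<forall>a\<in>carrier B. \<forall>b\<in>carrier B. \<forall>x\<in>add_center. ?f (a \<otimes> b) x = ?f a x \<oplus> ?f b x \<oplus> ?f a (?f b x)) \<or>
      (\<forall>a\<in>carrier B. \<forall>b\<in>carrier B. \<forall>x\<in>add_center. ?f (a \<otimes> b) x = ?f a x \<oplus> ?f b x \<oplus> ?f b (?f a x))"
      by blast
  next
    fix b x assume b: "b \<in> carrier B" and x: "x \<in> add_center" and fx: "?f b x = x"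
    have "?f b x \<oplus> x \<oplus> b = x \<otimes> b"
      using b x by (simp add: skew_rho_def word_simps)
    then have "x \<otimes> b = x \<oplus> x \<oplus> b"
      by (simp add: fx)
    then have "x \<otimes> (\<ominus> b) = \<ominus> b"
      using b x by (simp add: mult_minus word_simps)
    then show "x = \<zero>"
      using b x by (simp add: zero_eq_one)
  qed
  then show ?thesis
    using b x by (simp add: a_minus_def add.inv_solve_right')
qed

text \<open>Trivial actions mean bx = b + x and xb = x + b, so additive centrality of x carries over
  to multiplication and \<open>skew_lambda B x\<close> is the identity.\<close>

lemma perfect_add_center:
  assumes perf: "perfect_skew_brace B" and fin: "finite (carrier B)"
  shows "add_center \<subseteq> skew_center B"
proof
  fix x assume x: "x \<in> add_center"
  have l: "b \<otimes> x = b \<oplus> x" if "b \<in> carrier B" for b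
    using perfect_lambda_add_center[OF assms that x] that x
    by (metis skew_lambda_def add_inv_cancel(2) mult.m_closed add_center_carrier)
  have r: "x \<otimes> b = x \<oplus> b" if "b \<in> carrier B" for b
    using perfect_rho_add_center[OF assms that x] that x
    by (simp add: skew_rho_def a_minus_def add.inv_solve_right')
  show "x \<in> skew_center B"
    using x by (simp add: skew_center_def skew_lambda_def l r add_center_comm)
qed

end

section \<open>Normality and commutation of generated subgroups\<close>

text \<open>Conjugation is multiplicative, so generators suffice. Their conjugates need only lie in
  the generated subgroup: those met below are written as combinations of two generators.\<close>

lemma (in group) generate_normal:
  assumes H: "H \<subseteq> carrier G"
    and conj: "\<And>g h. g \<in> carrier G \<Longrightarrow> h \<in> H \<Longrightarrow> g \<otimes> h \<otimes> inv g \<in> generate G H"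
  shows "generate G H \<lhd> G"
proof (rule normal_invI)
  show sub: "subgroup (generate G H) G"
    using H by (rule generate_is_subgroup)
  fix g h assume g: "g \<in> carrier G" and h: "h \<in> generate G H"
  note incl = subsetD[OF generate_incl[OF H]]
  from h show "g \<otimes> h \<otimes> inv g \<in> generate G H"
  proof induction
    case one
    then show ?case using g by (simp add: generate.one)
  next
    case (incl h)
    then show ?case using g by (rule conj[rotated])
  next
    case (inv h)
    have "g \<otimes> inv h \<otimes> inv g = inv (g \<otimes> h \<otimes> inv g)"
      using g inv H by (simp add: inv_mult_group m_assoc subset_iff)
    then show ?case
      using subgroup.m_inv_closed[OF sub conj[OF g inv]] by simp
  next
    case (eng h k)
    have "g \<otimes> (h \<otimes> k) \<otimes> inv g = (g \<otimes> h \<otimes> inv g) \<otimes> (g \<otimes> k \<otimes> inv g)"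
      using g eng.hyps incl by (simp add: m_assoc inv_solve_left)
    then show ?case
      using generate.eng[OF eng.IH] by simp
  qed
qed

text \<open>The elements commuting with y form a subgroup. \<open>generate_commute\<close> uses this
  once on each side.\<close>

lemma (in group) generate_commute_elem:
  assumes H: "H \<subseteq> carrier G" and y: "y \<in> carrier G"
    and comm: "\<And>h. h \<in> H \<Longrightarrow> h \<otimes> y = y \<otimes> h"
    and x: "x \<in> generate G H"
  shows "x \<otimes> y = y \<otimes> x"
  using x
proof induction
  case (inv h)
  then have h: "h \<in> carrier G" using H by blast
  have "inv h \<otimes> y = inv h \<otimes> (y \<otimes> h) \<otimes> inv h"
    using h y by (simp add: m_assoc)
  also have "\<dots> = inv h \<otimes> (h \<otimes> y) \<otimes> inv h"
    by (simp only: comm[OF inv])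
  also have "\<dots> = y \<otimes> inv h"
    using h y by (simp flip: m_assoc)
  finally show ?case .
next
  case (eng h k)
  note hk = eng.hyps[THEN subsetD[OF generate_incl[OF H]]]
  have "h \<otimes> k \<otimes> y = h \<otimes> y \<otimes> k"
    using hk y by (simp add: m_assoc eng.IH(2))
  then show ?case
    using hk y by (simp add: eng.IH(1) m_assoc)
qed (use y comm in auto)

lemma (in group) generate_commute:
  assumes H: "H \<subseteq> carrier G" and K: "K \<subseteq> carrier G"
    and comm: "\<And>h k. h \<in> H \<Longrightarrow> k \<in> K \<Longrightarrow> h \<otimes> k = k \<otimes> h"
    and x: "x \<in> generate G H" and y: "y \<in> generate G K"
  shows "x \<otimes> y = y \<otimes> x"
proof (rule generate_commute_elem[OF H _ _ x])
  show "y \<in> carrier G" using y generate_incl[OF K] by blast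
  fix h assume h: "h \<in> H"
  show "h \<otimes> y = y \<otimes> h"
    using h H comm by (intro generate_commute_elem[OF K _ _ y, symmetric]) auto
qed

subsection \<open>The squares of the brace and of its opposite\<close>

context skew_brace
begin

text \<open>The star products a * b = -a + ab - b, which vanish exactly when ab = a + b. The
  subgroup \<open>square\<close> that they generate is usually written B^2.\<close>

definition star_set :: "'a set"
  where "star_set = {\<ominus> a \<oplus> a \<otimes> b \<ominus> b | a b. a \<in> carrier B \<and> b \<in> carrier B}"

text \<open>The star products of the opposite skew brace, whose addition is reversed; they vanish
  exactly when ab = b + a.\<close>

definition op_star_set :: "'a set"
  where "op_star_set = {\<ominus> b \<oplus> a \<otimes> b \<ominus> a | a b. a \<in> carrier B \<and> b \<in> carrier B}"

definition square :: "'a set"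
  where "square = generate (add_monoid B) star_set"

definition op_square :: "'a set"
  where "op_square = generate (add_monoid B) op_star_set"

lemma star_set_carrier: "star_set \<subseteq> carrier B"
  by (auto simp: star_set_def a_minus_def)

lemma op_star_set_carrier: "op_star_set \<subseteq> carrier B"
  by (auto simp: op_star_set_def a_minus_def)

lemma star_in_square:
  "a \<in> carrier B \<Longrightarrow> b \<in> carrier B \<Longrightarrow> \<ominus> a \<oplus> a \<otimes> b \<ominus> b \<in> square"
  unfolding square_def by (rule generate.incl) (auto simp: star_set_def)

lemma op_star_in_op_square:
  "a \<in> carrier B \<Longrightarrow> b \<in> carrier B \<Longrightarrow> \<ominus> b \<oplus> a \<otimes> b \<ominus> a \<in> op_square"
  unfolding op_square_def by (rule generate.incl) (auto simp: op_star_set_def)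

lemma square_subgroup: "subgroup square (add_monoid B)"
  unfolding square_def by (rule add.generate_is_subgroup) (rule star_set_carrier)

lemma op_square_subgroup: "subgroup op_square (add_monoid B)"
  unfolding op_square_def by (rule add.generate_is_subgroup) (rule op_star_set_carrier)

lemma square_normal: "square \<lhd> add_monoid B"
  unfolding square_def
proof (rule add.generate_normal[OF star_set_carrier])
  fix c h assume c: "c \<in> carrier B" and "h \<in> star_set"
  then obtain a b where ab: "a \<in> carrier B" "b \<in> carrier B" and h: "h = \<ominus> a \<oplus> a \<otimes> b \<ominus> b"
    by (auto simp: star_set_def)
  \<comment> \<open>The identity a * (c + b) = a * c + c + a * b - c, solved for the conjugate of a
    * b.\<close>
  have "c \<oplus> h \<oplus> \<ominus> c = \<ominus> (\<ominus> a \<oplus> a \<otimes> c \<ominus> c) \<oplus> (\<ominus> a \<oplus> a \<otimes> (c \<oplus> b) \<ominus> (c \<oplus> b))"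
    using ab c by (simp add: h skew_distrib_left word_simps)
  moreover have "\<dots> \<in> square"
    using subgroup.m_closed[OF square_subgroup] subgroup.m_inv_closed[OF square_subgroup] ab c
    by (simp add: star_in_square flip: a_inv_def)
  ultimately show "c \<oplus> h \<oplus> \<ominus> c \<in> generate (add_monoid B) star_set"
    by (simp add: square_def)
qed

end

context two_sided_skew_brace
begin

text \<open>As for \<open>square\<close>, but the sum is formed in the left factor, which calls for
  right distributivity.\<close>

lemma op_square_normal: "op_square \<lhd> add_monoid B"
  unfolding op_square_def
proof (rule add.generate_normal[OF op_star_set_carrier])
  fix c h assume c: "c \<in> carrier B" and "h \<in> op_star_set"
  then obtain a b where ab: "a \<in> carrier B" "b \<in> carrier B" and h: "h = \<ominus> b \<oplus> a \<otimes> b \<ominus> a"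
    by (auto simp: op_star_set_def)
  have "c \<oplus> h \<oplus> \<ominus> c = \<ominus> (\<ominus> b \<oplus> c \<otimes> b \<ominus> c) \<oplus> (\<ominus> b \<oplus> (c \<oplus> a) \<otimes> b \<ominus> (c \<oplus> a))"
    using ab c by (simp add: h skew_distrib_right word_simps)
  moreover have "\<dots> \<in> op_square"
    using subgroup.m_closed[OF op_square_subgroup] subgroup.m_inv_closed[OF op_square_subgroup] ab c
    by (simp add: op_star_in_op_square flip: a_inv_def)
  ultimately show "c \<oplus> h \<oplus> \<ominus> c \<in> generate (add_monoid B) op_star_set"
    by (simp add: op_square_def)
qed

text \<open>Applied to (a + b)(c + d), the left law first gives ac - c + bc - b - a + ad - d + bd,
  the right law first gives ac - a + ad - d - c + bc - b + bd. Cancel ac on the left and bd on the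
  right.\<close>

lemma star_op_star_commute:
  assumes "a \<in> carrier B" "b \<in> carrier B" "c \<in> carrier B" "d \<in> carrier B"
  shows "(\<ominus> a \<oplus> a \<otimes> d \<ominus> d) \<oplus> (\<ominus> c \<oplus> b \<otimes> c \<ominus> b) = (\<ominus> c \<oplus> b \<otimes> c \<ominus> b) \<oplus> (\<ominus> a \<oplus> a \<otimes> d \<ominus> d)"
proof -
  have "\<ominus> (a \<otimes> c) \<oplus> (a \<oplus> b) \<otimes> (c \<oplus> d) \<ominus> b \<otimes> d
      = (\<ominus> c \<oplus> b \<otimes> c \<ominus> b) \<oplus> (\<ominus> a \<oplus> a \<otimes> d \<ominus> d)"
    using assms by (subst skew_distrib_left) (simp_all add: skew_distrib_right word_simps)
  moreover have "\<ominus> (a \<otimes> c) \<oplus> (a \<oplus> b) \<otimes> (c \<oplus> d) \<ominus> b \<otimes> d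
      = (\<ominus> a \<oplus> a \<otimes> d \<ominus> d) \<oplus> (\<ominus> c \<oplus> b \<otimes> c \<ominus> b)"
    using assms by (subst skew_distrib_right) (simp_all add: skew_distrib_left word_simps)
  ultimately show ?thesis by simp
qed

lemma square_op_square_commute:
  assumes "x \<in> square" "y \<in> op_square"
  shows "x \<oplus> y = y \<oplus> x"
proof (rule add.generate_commute[OF star_set_carrier op_star_set_carrier])
  fix h k assume "h \<in> star_set" "k \<in> op_star_set"
  then show "h \<oplus> k = k \<oplus> h"
    by (auto simp: star_set_def op_star_set_def intro: star_op_star_commute)
qed (use assms in \<open>auto simp: square_def op_square_def\<close>)

text \<open>In the additive quotient by the sum \<open>J\<close> of both subgroups, the image of ab
  is the product of the images in either order. So the quotient is abelian, the projection respects
  both operations, and perfectness makes it trivial.\<close>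

lemma perfect_decomp:
  assumes perf: "perfect_skew_brace B" and x: "x \<in> carrier B"
  shows "\<exists>s\<in>square. \<exists>t\<in>op_square. x = t \<oplus> s"
proof -
  define J where "J = op_square <#>\<^bsub>add_monoid B\<^esub> square"
  have J: "J \<lhd> add_monoid B"
    unfolding J_def by (rule add.normal_subgroup_set_mult_closed[OF op_square_normal square_normal])
  have J_memI: "t \<oplus> s \<in> J" if "t \<in> op_square" "s \<in> square" for s t
    using that by (auto simp: J_def set_mult_def)
  interpret J: normal J "add_monoid B" by (rule J)
  let ?Q = "add_monoid B Mod J" and ?q = "\<lambda>x. J #>\<^bsub>add_monoid B\<^esub> x"
  interpret Q: group ?Q by (rule J.factorgroup_is_group)
  have q: "?q \<in> hom (add_monoid B) ?Q" by (rule J.r_coset_hom_Mod)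
  have qc: "?q a \<in> carrier ?Q" if "a \<in> carrier B" for a
    using hom_in_carrier[OF q] that by simp
  have q_add: "?q (a \<oplus> b) = ?q a \<otimes>\<^bsub>?Q\<^esub> ?q b" if "a \<in> carrier B" "b \<in> carrier B" for a b
    using hom_mult[OF q] that by simp
  \<comment> \<open>A summand from \<open>J\<close> may be dropped from the middle of a sum. This is
    applied to ab = a + (-a + ab - b) + b and ab = b + (-b + ab - a) + a.\<close>
  have q_J: "?q (a \<oplus> j \<oplus> b) = ?q a \<otimes>\<^bsub>?Q\<^esub> ?q b" if "a \<in> carrier B" "b \<in> carrier B" and j: "j \<in> J" for a b j
  proof -
    have jc: "j \<in> carrier B" using J.mem_carrier[OF j] by simp
    have qj: "?q j = \<one>\<^bsub>?Q\<^esub>"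
      using add.coset_join2[OF jc J.subgroup_axioms j] by (simp add: FactGroup_def)
    have "?q (a \<oplus> j \<oplus> b) = ?q a \<otimes>\<^bsub>?Q\<^esub> ?q j \<otimes>\<^bsub>?Q\<^esub> ?q b"
      using that jc by (simp only: q_add add.m_closed)
    then show ?thesis
      unfolding qj Q.r_one[OF qc[OF that(1)]] .
  qed
  have one: "\<zero> \<in> square" "\<zero> \<in> op_square"
    by (simp_all add: square_def op_square_def generate.one[of "add_monoid B", simplified])
  have q_mult: "?q (a \<otimes> b) = ?q a \<otimes>\<^bsub>?Q\<^esub> ?q b" if ab: "a \<in> carrier B" "b \<in> carrier B" for a b
  proof -
    have "\<ominus> a \<oplus> a \<otimes> b \<ominus> b \<in> J"
      using J_memI[OF one(2) star_in_square[OF ab]] ab by (simp add: a_minus_def)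
    moreover have "a \<otimes> b = a \<oplus> (\<ominus> a \<oplus> a \<otimes> b \<ominus> b) \<oplus> b"
      using ab by (simp add: word_simps)
    ultimately show ?thesis
      using q_J[OF ab] by metis
  qed
  have q_mult': "?q (a \<otimes> b) = ?q b \<otimes>\<^bsub>?Q\<^esub> ?q a" if ab: "a \<in> carrier B" "b \<in> carrier B" for a b
  proof -
    have "\<ominus> b \<oplus> a \<otimes> b \<ominus> a \<in> J"
      using J_memI[OF op_star_in_op_square[OF ab] one(1)] ab by (simp add: a_minus_def)
    moreover have "a \<otimes> b = b \<oplus> (\<ominus> b \<oplus> a \<otimes> b \<ominus> a) \<oplus> a"
      using ab by (simp add: word_simps)
    ultimately show ?thesis
      using q_J[OF ab(2,1)] by metis
  qed
  have "comm_group ?Q"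
  proof (rule Q.group_comm_groupI)
    fix u v assume "u \<in> carrier ?Q" "v \<in> carrier ?Q"
    then obtain a b where "a \<in> carrier B" "b \<in> carrier B" "u = ?q a" "v = ?q b"
      by (auto simp: FactGroup_def RCOSETS_def)
    then show "u \<otimes>\<^bsub>?Q\<^esub> v = v \<otimes>\<^bsub>?Q\<^esub> u"
      using q_mult q_mult' by metis
  qed
  moreover have "?q \<in> hom B ?Q"
    using qc q_mult by (intro homI)
  ultimately have "?q x = \<one>\<^bsub>?Q\<^esub>"
    using perfect_hom_trivial[OF perf _ _ q x] by blast
  then have "?q x = J" by (simp add: FactGroup_def)
  then have "x \<in> J"
    using add.coset_join1[OF _ x J.subgroup_axioms] by blast
  then show ?thesis
    by (auto simp: J_def set_mult_def)
qed

lemma square_carrier [simp]: "x \<in> square \<Longrightarrow> x \<in> carrier B"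
  using subgroup.mem_carrier[OF square_subgroup] by simp

lemma op_square_carrier [simp]: "x \<in> op_square \<Longrightarrow> x \<in> carrier B"
  using subgroup.mem_carrier[OF op_square_subgroup] by simp

lemma square_closed:
  "\<zero> \<in> square" "x \<in> square \<Longrightarrow> y \<in> square \<Longrightarrow> x \<oplus> y \<in> square" "x \<in> square \<Longrightarrow> \<ominus> x \<in> square"
  using subgroup.one_closed[OF square_subgroup] subgroup.m_closed[OF square_subgroup]
    subgroup.m_inv_closed[OF square_subgroup, of x]
  by (simp_all add: a_inv_def)

lemma op_square_closed:
  "\<zero> \<in> op_square" "x \<in> op_square \<Longrightarrow> y \<in> op_square \<Longrightarrow> x \<oplus> y \<in> op_square"
  "x \<in> op_square \<Longrightarrow> \<ominus> x \<in> op_square"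
  using subgroup.one_closed[OF op_square_subgroup] subgroup.m_closed[OF op_square_subgroup]
    subgroup.m_inv_closed[OF op_square_subgroup, of x]
  by (simp_all add: a_inv_def)

text \<open>As a member of either subgroup x commutes with the other one, and together they fill B
  by \<open>perfect_decomp\<close>.\<close>

lemma perfect_square_Int_op_square:
  assumes perf: "perfect_skew_brace B" and x: "x \<in> square" "x \<in> op_square"
  shows "x \<in> add_center"
proof (rule add_centerI)
  show "x \<in> carrier B" using x by simp
  fix y assume "y \<in> carrier B"
  then obtain s t where st: "s \<in> square" "t \<in> op_square" "y = t \<oplus> s"
    using perfect_decomp[OF perf] by blast
  have "x \<oplus> (t \<oplus> s) = t \<oplus> x \<oplus> s"
    using st x by (simp add: square_op_square_commute flip: add.m_assoc)
  also have "\<dots> = t \<oplus> s \<oplus> x"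
    using st x by (simp add: square_op_square_commute[of s x] add.m_assoc)
  finally show "x \<oplus> y = y \<oplus> x" by (simp add: st)
qed

end

text \<open>A plain monoid record: updating the carrier of B would keep the ring fields in the type,
  while the factors are to have type \<open>'a monoid\<close>.\<close>

definition submonoid_of :: "('a, 'm) monoid_scheme \<Rightarrow> 'a set \<Rightarrow> 'a monoid"
  where "submonoid_of B H = \<lparr> carrier = H, monoid.mult = monoid.mult B, one = one B \<rparr>"

lemma submonoid_of_simps [simp]:
  "carrier (submonoid_of B H) = H"
  "monoid.mult (submonoid_of B H) = monoid.mult B"
  "one (submonoid_of B H) = one B"
  by (simp_all add: submonoid_of_def)

lemma (in group) group_submonoid_of:
  assumes H: "subgroup H G"
  shows "group (submonoid_of G H)"
proof (rule groupI)
  fix x assume "x \<in> carrier (submonoid_of G H)"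
  then have x: "x \<in> H" by simp
  then have "inv x \<in> H" "inv x \<otimes> x = \<one>"
    using H by (simp_all add: subgroup.m_inv_closed subgroup.mem_carrier)
  then show "\<exists>y\<in>carrier (submonoid_of G H). y \<otimes>\<^bsub>submonoid_of G H\<^esub> x = \<one>\<^bsub>submonoid_of G H\<^esub>"
    by auto
qed (use H in \<open>simp_all add: subgroup.m_closed subgroup.one_closed subgroup.mem_carrier m_assoc\<close>)

subsection \<open>The direct decomposition\<close>

locale centerless_perfect_brace = two_sided_skew_brace +
  assumes perfect: "perfect_skew_brace B" and fin: "finite (carrier B)"
    and centerless: "skew_center B = {\<zero>}"
begin

lemma Int_zero: "x \<in> square \<Longrightarrow> x \<in> op_square \<Longrightarrow> x = \<zero>"
  using perfect_square_Int_op_square[OF perfect] perfect_add_center[OF perfect fin] centerless by blast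

text \<open>The second form of ab lies in \<open>op_square\<close>, hence so does \<open>?s\<close>;
  it is in \<open>square\<close> as well and vanishes by \<open>Int_zero\<close>. This makes
  \<open>op_square\<close> the factor \<open>Triv\<close>.\<close>

lemma mult_op_square:
  assumes a: "a \<in> op_square" and b: "b \<in> op_square"
  shows "a \<otimes> b = a \<oplus> b"
proof -
  let ?s = "\<ominus> a \<oplus> a \<otimes> b \<ominus> b" and ?t = "\<ominus> b \<oplus> a \<otimes> b \<ominus> a"
  have ab: "a \<otimes> b = a \<oplus> ?s \<oplus> b" "a \<otimes> b = b \<oplus> ?t \<oplus> a"
    using a b by (simp_all add: word_simps)
  have "b \<oplus> ?t \<oplus> a \<in> op_square"
    using a b by (intro op_square_closed op_star_in_op_square) simp_all
  then have "a \<otimes> b \<in> op_square"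
    using ab(2) by simp
  then have "?s \<in> op_square"
    using a b by (simp add: a_minus_def op_square_closed)
  then have "?s = \<zero>"
    using a b by (intro Int_zero star_in_square) simp_all
  then show ?thesis
    using ab(1) a b by simp
qed

text \<open>Here \<open>?t\<close> is the element that lies in both subgroups, so multiplication is
  reversed addition and \<open>square\<close> becomes the factor \<open>aTriv\<close>.\<close>

lemma mult_square:
  assumes a: "a \<in> square" and b: "b \<in> square"
  shows "a \<otimes> b = b \<oplus> a"
proof -
  let ?s = "\<ominus> a \<oplus> a \<otimes> b \<ominus> b" and ?t = "\<ominus> b \<oplus> a \<otimes> b \<ominus> a"
  have ab: "a \<otimes> b = a \<oplus> ?s \<oplus> b" "a \<otimes> b = b \<oplus> ?t \<oplus> a"
    using a b by (simp_all add: word_simps)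
  have "a \<oplus> ?s \<oplus> b \<in> square"
    using a b by (intro square_closed star_in_square) simp_all
  then have "a \<otimes> b \<in> square"
    using ab(1) by simp
  then have "?t \<in> square"
    using a b by (simp add: a_minus_def square_closed)
  then have "?t = \<zero>"
    using a b by (intro Int_zero op_star_in_op_square) simp_all
  then show ?thesis
    using ab(2) a b by simp
qed

text \<open>Moving x to the front of y + \<open>?t\<close> + x shows that \<open>?s\<close> is the
  conjugate y + \<open>?t\<close> - y. It lies in both subgroups and vanishes.\<close>

lemma mult_square_op_square:
  assumes x: "x \<in> square" and y: "y \<in> op_square"
  shows "x \<otimes> y = y \<oplus> x"
proof -
  let ?s = "\<ominus> x \<oplus> x \<otimes> y \<ominus> y" and ?t = "\<ominus> y \<oplus> x \<otimes> y \<ominus> x"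
  have s: "?s \<in> square" and t: "?t \<in> op_square"
    using x y by (simp_all add: star_in_square op_star_in_op_square)
  have "x \<otimes> y = y \<oplus> ?t \<oplus> x"
    using x y by (simp add: word_simps)
  also have "\<dots> = x \<oplus> (y \<oplus> ?t)"
    using x y t by (intro square_op_square_commute[symmetric] op_square_closed)
  finally have xy: "x \<otimes> y = x \<oplus> (y \<oplus> ?t)" .
  then have "?s = \<ominus> x \<oplus> (x \<oplus> (y \<oplus> ?t)) \<ominus> y"
    by simp
  also have "\<dots> = y \<oplus> ?t \<oplus> \<ominus> y"
    using x y t op_square_carrier[OF t] unfolding a_minus_def[of B _ y]
    by (subst add_inv_cancel) auto
  also have "\<dots> \<in> op_square"
    using y t by (intro op_square_closed)
  finally have "?s = \<zero>"
    using s by (intro Int_zero)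
  moreover have "x \<otimes> y = x \<oplus> ?s \<oplus> y"
    using x y by (simp add: word_simps)
  ultimately show ?thesis
    using x y square_op_square_commute[OF x y] by simp
qed

text \<open>Dually, \<open>?t\<close> is the conjugate -x + \<open>?s\<close> + x, hence
  zero.\<close>

lemma mult_op_square_square:
  assumes x: "x \<in> square" and y: "y \<in> op_square"
  shows "y \<otimes> x = y \<oplus> x"
proof -
  let ?s = "\<ominus> y \<oplus> y \<otimes> x \<ominus> x" and ?t = "\<ominus> x \<oplus> y \<otimes> x \<ominus> y"
  have s: "?s \<in> square" and t: "?t \<in> op_square"
    using x y by (simp_all add: star_in_square op_star_in_op_square)
  have "y \<otimes> x = y \<oplus> ?s \<oplus> x"
    using x y by (simp add: word_simps)
  also have "\<dots> = y \<oplus> (?s \<oplus> x)"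
    using x y s square_carrier[OF s] by (intro add.m_assoc) simp_all
  also have "\<dots> = ?s \<oplus> x \<oplus> y"
    using x y s by (intro square_op_square_commute[symmetric] square_closed)
  finally have "?t = \<ominus> x \<oplus> (?s \<oplus> x \<oplus> y) \<ominus> y"
    by simp
  also have "\<dots> = \<ominus> x \<oplus> ?s \<oplus> x"
    using x y square_carrier[OF s] unfolding a_minus_def[of B _ y]
    by (simp only: add.m_assoc add.m_closed add.inv_closed add.r_inv add.r_one square_carrier op_square_carrier)
  also have "\<dots> \<in> square"
    using x s by (intro square_closed)
  finally have "?t = \<zero>"
    using t by (intro Int_zero)
  moreover have "y \<otimes> x = x \<oplus> ?t \<oplus> y"
    using x y by (simp add: word_simps)
  ultimately show ?thesis
    using x y square_op_square_commute[OF x y] by simp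
qed

lemma inv_eq_minus:
  assumes "x \<in> square \<or> x \<in> op_square"
  shows "inv x = \<ominus> x"
proof (rule mult.inv_equality)
  show "\<ominus> x \<otimes> x = \<one>"
    using assms by (auto simp: mult_square mult_op_square square_closed op_square_closed zero_eq_one)
qed (use assms in auto)

lemma square_mult_subgroup: "subgroup square B"
proof (rule mult.subgroupI)
  show "square \<noteq> {}" using square_closed(1) by blast
qed (auto simp: mult_square inv_eq_minus square_closed)

lemma op_square_mult_subgroup: "subgroup op_square B"
proof (rule mult.subgroupI)
  show "op_square \<noteq> {}" using op_square_closed(1) by blast
qed (auto simp: mult_op_square inv_eq_minus op_square_closed)

text \<open>The element -t' + t = s' - s lies in both subgroups.\<close>

lemma decomp_unique:
  assumes s: "s \<in> square" "s' \<in> square" and t: "t \<in> op_square" "t' \<in> op_square"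
    and eq: "t \<oplus> s = t' \<oplus> s'"
  shows "t = t'" "s = s'"
proof -
  have "\<ominus> t' \<oplus> (t \<oplus> s) \<ominus> s = \<ominus> t' \<oplus> (t' \<oplus> s') \<ominus> s"
    by (simp add: eq)
  then have d: "\<ominus> t' \<oplus> t = s' \<oplus> \<ominus> s"
    using s t by (simp add: word_simps)
  moreover have "\<ominus> t' \<oplus> t \<in> op_square" "s' \<oplus> \<ominus> s \<in> square"
    using s t by (simp_all add: square_closed op_square_closed)
  ultimately have z: "\<ominus> t' \<oplus> t = \<zero>"
    using Int_zero by metis
  have "t' \<oplus> (\<ominus> t' \<oplus> t) = t'"
    unfolding z using t by simp
  then show tt: "t = t'"
    using t by simp
  show "s = s'"
    using eq s t by (simp add: tt)
qed

lemma decomp_add: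
  assumes s: "s \<in> square" "s' \<in> square" and t: "t \<in> op_square" "t' \<in> op_square"
  shows "(t \<oplus> s) \<oplus> (t' \<oplus> s') = (t \<oplus> t') \<oplus> (s \<oplus> s')"
proof -
  have "(t \<oplus> s) \<oplus> (t' \<oplus> s') = t \<oplus> ((s \<oplus> t') \<oplus> s')"
    using s t by (simp add: add.m_assoc)
  also have "s \<oplus> t' = t' \<oplus> s"
    using s t by (intro square_op_square_commute)
  also have "t \<oplus> ((t' \<oplus> s) \<oplus> s') = (t \<oplus> t') \<oplus> (s \<oplus> s')"
    using s t by (simp add: add.m_assoc)
  finally show ?thesis .
qed

text \<open>Writing each sum t + s as the product ts reduces the claim to s and t' commuting
  multiplicatively; both mixed products equal t' + s.\<close>

lemma decomp_mult:
  assumes s: "s \<in> square" "s' \<in> square" and t: "t \<in> op_square" "t' \<in> op_square"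
  shows "(t \<oplus> s) \<otimes> (t' \<oplus> s') = (t \<otimes> t') \<oplus> (s \<otimes> s')"
proof -
  have "(t \<oplus> s) \<otimes> (t' \<oplus> s') = (t \<otimes> s) \<otimes> (t' \<otimes> s')"
    using s t by (simp add: mult_op_square_square)
  also have "\<dots> = t \<otimes> ((s \<otimes> t') \<otimes> s')"
    using s t by (simp add: mult.m_assoc)
  also have "s \<otimes> t' = t' \<otimes> s"
    using s t by (simp add: mult_op_square_square mult_square_op_square)
  also have "t \<otimes> ((t' \<otimes> s) \<otimes> s') = (t \<otimes> t') \<otimes> (s \<otimes> s')"
    using s t by (simp add: mult.m_assoc)
  also have "\<dots> = (t \<otimes> t') \<oplus> (s \<otimes> s')"
    using s t subgroup.m_closed[OF square_mult_subgroup] subgroup.m_closed[OF op_square_mult_subgroup]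
    by (intro mult_op_square_square)
  finally show ?thesis .
qed

lemma iso_Triv_aTriv:
  shows "perfect_group (submonoid_of B op_square)" "perfect_group (submonoid_of B square)"
    "B \<simeq>\<^sub>s\<^sub>b RDirProd (Triv (submonoid_of B op_square)) (aTriv (submonoid_of B square))"
proof -
  let ?G = "submonoid_of B op_square" and ?H = "submonoid_of B square"
  have "\<forall>x\<in>carrier B. \<exists>ts. snd ts \<in> square \<and> fst ts \<in> op_square \<and> x = fst ts \<oplus> snd ts"
    using perfect_decomp[OF perfect] by force
  then obtain f where f: "\<And>x. x \<in> carrier B \<Longrightarrow> snd (f x) \<in> square"
    "\<And>x. x \<in> carrier B \<Longrightarrow> fst (f x) \<in> op_square"
    "\<And>x. x \<in> carrier B \<Longrightarrow> fst (f x) \<oplus> snd (f x) = x"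
    by (metis bchoice)
  \<comment> \<open>By uniqueness the chosen \<open>f\<close> inverts (t, s) \<mapsto> t + s, so
    \<open>decomp_add\<close> and \<open>decomp_mult\<close> carry over to \<open>f\<close>.\<close>
  have f_eq: "f (t \<oplus> s) = (t, s)" if "t \<in> op_square" "s \<in> square" for s t
  proof -
    have "t \<oplus> s \<in> carrier B" using that by simp
    from decomp_unique[OF f(1)[OF this] that(2) f(2)[OF this] that(1) f(3)[OF this]]
    show ?thesis by (simp add: prod_eq_iff)
  qed
  have f_add: "f (x \<oplus> y) = (fst (f x) \<oplus> fst (f y), snd (f x) \<oplus> snd (f y))"
    if "x \<in> carrier B" "y \<in> carrier B" for x y
    using f_eq[of "fst (f x) \<oplus> fst (f y)" "snd (f x) \<oplus> snd (f y)"]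
      decomp_add[of "snd (f x)" "snd (f y)" "fst (f x)" "fst (f y)"] that
    by (simp add: f square_closed op_square_closed)
  have f_mult: "f (x \<otimes> y) = (fst (f x) \<otimes> fst (f y), snd (f x) \<otimes> snd (f y))"
    if "x \<in> carrier B" "y \<in> carrier B" for x y
    using f_eq[of "fst (f x) \<otimes> fst (f y)" "snd (f x) \<otimes> snd (f y)"]
      decomp_mult[of "snd (f x)" "snd (f y)" "fst (f x)" "fst (f y)"] that
      subgroup.m_closed[OF square_mult_subgroup] subgroup.m_closed[OF op_square_mult_subgroup]
    by (simp add: f)
  have f_op: "f t = (t, \<zero>)" if "t \<in> op_square" for t
    using f_eq[OF that square_closed(1)] that by simp
  have f_sq: "f s = (\<zero>, s)" if "s \<in> square" for s
    using f_eq[OF op_square_closed(1) that] that by simp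
  \<comment> \<open>Each factor is the image of B under a coordinate of \<open>f\<close>, so it
    inherits perfectness.\<close>
  show "perfect_group ?G"
  proof (rule perfect_group_image[OF perfect, of _ "\<lambda>x. fst (f x)"])
    show "group ?G" by (rule mult.group_submonoid_of) (rule op_square_mult_subgroup)
    show "(\<lambda>x. fst (f x)) \<in> hom B ?G" by (rule homI) (simp_all add: f f_mult)
    show "(\<lambda>x. fst (f x)) ` carrier B = carrier ?G"
    proof (intro equalityI subsetI)
      fix x assume "x \<in> carrier ?G"
      then have x: "x \<in> op_square" by simp
      show "x \<in> (\<lambda>x. fst (f x)) ` carrier B"
        by (rule image_eqI[of _ _ x]) (use x f_op in simp_all)
    qed (auto simp: f)
    show "fst (f (a \<oplus> b)) = fst (f a) \<otimes>\<^bsub>?G\<^esub> fst (f b) \<or> fst (f (a \<oplus> b)) = fst (f b) \<otimes>\<^bsub>?G\<^esub> fst (f a)"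
      if "a \<in> carrier B" "b \<in> carrier B" for a b
      using that by (simp add: f_add f mult_op_square)
  qed
  show "perfect_group ?H"
  proof (rule perfect_group_image[OF perfect, of _ "\<lambda>x. snd (f x)"])
    show "group ?H" by (rule mult.group_submonoid_of) (rule square_mult_subgroup)
    show "(\<lambda>x. snd (f x)) \<in> hom B ?H" by (rule homI) (simp_all add: f f_mult)
    show "(\<lambda>x. snd (f x)) ` carrier B = carrier ?H"
    proof (intro equalityI subsetI)
      fix x assume "x \<in> carrier ?H"
      then have x: "x \<in> square" by simp
      show "x \<in> (\<lambda>x. snd (f x)) ` carrier B"
        by (rule image_eqI[of _ _ x]) (use x f_sq in simp_all)
    qed (auto simp: f)
    \<comment> \<open>The second alternative holds, multiplication on \<open>square\<close> being
      reversed addition.\<close>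
    show "snd (f (a \<oplus> b)) = snd (f a) \<otimes>\<^bsub>?H\<^esub> snd (f b) \<or> snd (f (a \<oplus> b)) = snd (f b) \<otimes>\<^bsub>?H\<^esub> snd (f a)"
      if "a \<in> carrier B" "b \<in> carrier B" for a b
      using that by (simp add: f_add f mult_square)
  qed
  let ?P = "RDirProd (Triv ?G) (aTriv ?H)"
  have f_mem: "f x \<in> op_square \<times> square" if "x \<in> carrier B" for x
    using f(1,2)[OF that] by (simp add: mem_Times_iff)
  have carr: "carrier ?P = op_square \<times> square"
    by (simp add: RDirProd_carrier Triv_def aTriv_def)
  have "bij_betw f (carrier B) (op_square \<times> square)"
  proof (rule bij_betw_byWitness[where f' = "\<lambda>(t, s). t \<oplus> s"])
    show "f ` carrier B \<subseteq> op_square \<times> square"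
      by (rule image_subsetI) (rule f_mem)
  qed (use f f_eq in \<open>auto simp: case_prod_beta\<close>)
  \<comment> \<open>Addition in each factor is defined by its multiplication;
    \<open>mult_op_square\<close> and \<open>mult_square\<close> turn it back into addition of
    B.\<close>
  moreover have "f \<in> hom (add_monoid B) (add_monoid ?P)"
    by (rule homI)
      (use f_mem in \<open>auto simp: RDirProd_def monoid.defs Triv_def aTriv_def f_add f mult_op_square mult_square mult_DirProd'\<close>)
  moreover have "f \<in> hom B ?P"
    by (rule homI)
      (use f_mem in \<open>auto simp: RDirProd_def monoid.defs Triv_def aTriv_def f_mult mult_DirProd'\<close>)
  ultimately show "B \<simeq>\<^sub>s\<^sub>b ?P"
    unfolding skew_brace_iso_def carr by blast
qed

end

theorem corollary2:
  fixes B :: "('a, 'm) ring_scheme"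
  assumes "two_sided_skew_brace B"
    and "finite (carrier B)"
    and "perfect_skew_brace B"
    and "skew_center B = {\<zero>\<^bsub>B\<^esub>}"
  shows "\<exists>(G :: 'a monoid) (H :: 'a monoid).
           group G \<and> finite (carrier G) \<and> perfect_group G \<and>
           group H \<and> finite (carrier H) \<and> perfect_group H \<and>
           B \<simeq>\<^sub>s\<^sub>b RDirProd (Triv G) (aTriv H)"
proof -
  interpret centerless_perfect_brace B
    using assms by (simp add: centerless_perfect_brace_def centerless_perfect_brace_axioms_def)
  have "op_square \<subseteq> carrier B" "square \<subseteq> carrier B"
    by auto
  then have "finite op_square" "finite square"
    using fin by (blast intro: finite_subset)+
  then show ?thesis
    using iso_Triv_aTriv mult.group_submonoid_of[OF op_square_mult_subgroup]
      mult.group_submonoid_of[OF square_mult_subgroup]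
    by (intro exI[of _ "submonoid_of B op_square"] exI[of _ "submonoid_of B square"] conjI) simp_all
qed

end
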